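(* For all integers $r\ge 3$ and $t\ge 3$, and all $n\ge 2t-2$, $\operatorname{sat}_{K_r}(n,S_t)=0$. Moreover, for all $r\ge 3$: $\operatorname{sat}_{K_r}(n,S_1)=0$ for all $n\ge 2$, and $\operatorname{sat}_{K_r}(n,S_2)=0$ for all $n\ge 3$.
   Context: All graphs are finite and simple. $S_t=K_{1,t}$ is the star with $t$ edges and $t+1$ vertices. A graph $G$ is $F$-saturated if $G$ contains no copy of $F$ as a (not necessarily induced) subgraph, but adding any missing edge to $G$ creates at least one copy of $F$. $\operatorname{sat}_H(n,F)$ denotes the minimum number of copies of $H$ (as a not necessarily induced subgraph) among all $F$-saturated graphs on $n$ vertices. *)

theory Defs
  imports Main "HOL-Library.Extended_Nat"
begin

record 'a graph =
  verts :: "'a set"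
  edges :: "'a set set"

definition simple_graph :: "'a graph \<Rightarrow> bool" where
  "simple_graph G \<longleftrightarrow> finite (verts G) \<and> (\<forall>e\<in>edges G. e \<subseteq> verts G \<and> card e = 2)"

definition subgraph :: "'a graph \<Rightarrow> 'a graph \<Rightarrow> bool" where
  "subgraph K G \<longleftrightarrow> simple_graph K \<and> verts K \<subseteq> verts G \<and> edges K \<subseteq> edges G"

definition isomorphic :: "'a graph \<Rightarrow> 'b graph \<Rightarrow> bool" where
  "isomorphic G H \<longleftrightarrow>
     (\<exists>f. bij_betw f (verts G) (verts H) \<and> (\<lambda>e. f ` e) ` edges G = edges H)"

text \<open>A copy of \<open>H\<close> in \<open>G\<close> is a (not necessarily induced) subgraph of \<open>G\<close> isomorphic to \<open>H\<close>,
  so copies are counted as subgraphs, not as embeddings of \<open>H\<close>.\<close>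

definition copies :: "'b graph \<Rightarrow> 'a graph \<Rightarrow> 'a graph set" where
  "copies H G = {K. subgraph K G \<and> isomorphic K H}"

definition contains_copy :: "'a graph \<Rightarrow> 'b graph \<Rightarrow> bool" where
  "contains_copy G F \<longleftrightarrow> copies F G \<noteq> {}"

definition add_edge :: "'a graph \<Rightarrow> 'a \<Rightarrow> 'a \<Rightarrow> 'a graph" where
  "add_edge G u v = \<lparr>verts = verts G, edges = insert {u, v} (edges G)\<rparr>"

definition saturated :: "'b graph \<Rightarrow> 'a graph \<Rightarrow> bool" where
  "saturated F G \<longleftrightarrow> simple_graph G \<and> \<not> contains_copy G F \<and>
     (\<forall>u\<in>verts G. \<forall>v\<in>verts G. u \<noteq> v \<and> {u, v} \<notin> edges G \<longrightarrow> contains_copy (add_edge G u v) F)"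

text \<open>Every finite graph is isomorphic to one with vertices in \<open>nat\<close>, so it suffices to range over
  such graphs. The infimum is taken in \<open>enat\<close>, where it is a minimum whenever some \<open>F\<close>-saturated
  graph on \<open>n\<close> vertices exists, and \<open>\<infinity>\<close> (rather than \<open>0\<close>) when none does.\<close>

definition sat :: "'b graph \<Rightarrow> nat \<Rightarrow> 'c graph \<Rightarrow> enat" where
  "sat H n F =
     (INF G \<in> {G :: nat graph. saturated F G \<and> card (verts G) = n}. enat (card (copies H G)))"

definition complete_graph :: "nat \<Rightarrow> nat graph" where
  "complete_graph r = \<lparr>verts = {..<r}, edges = {e. e \<subseteq> {..<r} \<and> card e = 2}\<rparr>"

text \<open>The star with centre \<open>0\<close> and leaves \<open>1, \<dots>, t\<close>.\<close>

definition star :: "nat \<Rightarrow> nat graph" where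
  "star t = \<lparr>verts = {0..t}, edges = {{0, i} | i. i \<in> {1..t}}\<rparr>"

end

theory Submission
  imports Defs "HOL-Number_Theory.Cong"
begin

text \<open>
  A graph is \<open>S\<^sub>t\<close>-saturated as soon as no vertex has degree \<open>t\<close> or more and, of any two distinct
  vertices, at least one has degree exactly \<open>t - 1\<close>: a new edge then raises the degree of that
  vertex to \<open>t\<close> (\<open>star_saturatedI\<close>). A bipartite graph contains no triangle, hence no \<open>K\<^sub>r\<close> with
  \<open>r \<ge> 3\<close> (\<open>two_coloured_no_clique\<close>). It is therefore enough to find, for \<open>d = t - 1\<close> and every
  \<open>n \<ge> 2 d\<close>, a bipartite graph on \<open>n\<close> vertices in which all vertices but at most one have degree
  \<open>d\<close>, and the exceptional vertex has degree at most \<open>d\<close>.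

  Let \<open>m\<close> be half of \<open>n\<close>, rounded down, so that \<open>d \<le> m\<close>. Two classes of \<open>m\<close> vertices each, both
  indexed by the residues modulo \<open>m\<close>, are joined by the rule that \<open>i\<close> is adjacent to \<open>j\<close> iff \<open>i + j\<close>
  has residue less than \<open>d\<close>. This graph is \<open>d\<close>-regular, because translation by \<open>i\<close> permutes the
  residues (\<open>card_translates_below\<close>). If \<open>n\<close> is odd, one isolated vertex is added. The argument is
  uniform in \<open>t \<ge> 1\<close>, so that the stars with one and two edges need no separate construction.
\<close>

section \<open>Stars and cliques in a graph\<close>

definition neighbours :: "'a graph \<Rightarrow> 'a \<Rightarrow> 'a set" where
  "neighbours G v = {w. {v, w} \<in> edges G}"

lemma neighbours_subset_verts:
  assumes "simple_graph G"
  shows "neighbours G v \<subseteq> verts G"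
  using assms by (auto simp: neighbours_def simple_graph_def)

lemma finite_neighbours:
  assumes "simple_graph G"
  shows "finite (neighbours G v)"
  using finite_subset[OF neighbours_subset_verts[OF assms]] assms
  by (simp add: simple_graph_def)

lemma not_self_neighbour:
  assumes "simple_graph G"
  shows "v \<notin> neighbours G v"
  using assms by (fastforce simp: neighbours_def simple_graph_def)

lemma simple_graph_add_edge:
  assumes "simple_graph G" "u \<in> verts G" "v \<in> verts G" "u \<noteq> v"
  shows "simple_graph (add_edge G u v)"
  using assms by (auto simp: simple_graph_def add_edge_def)

text \<open>The inverse of the isomorphism from a copy of \<open>H\<close> onto \<open>H\<close> embeds \<open>H\<close> into \<open>G\<close>.\<close>

lemma embedding_of_copy:
  assumes "K \<in> copies H G"
  obtains g where "inj_on g (verts H)" "g ` verts H \<subseteq> verts G"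
    "\<forall>x y. {x, y} \<in> edges H \<longrightarrow> {g x, g y} \<in> edges G"
proof -
  from assms obtain f where K: "simple_graph K" "verts K \<subseteq> verts G" "edges K \<subseteq> edges G"
    and f: "bij_betw f (verts K) (verts H)" "(\<lambda>e. f ` e) ` edges K = edges H"
    by (auto simp: copies_def subgraph_def isomorphic_def)
  define g where "g = inv_into (verts K) f"
  have g: "bij_betw g (verts H) (verts K)"
    unfolding g_def by (rule bij_betw_inv_into[OF f(1)])
  show thesis
  proof
    show "inj_on g (verts H)" "g ` verts H \<subseteq> verts G"
      using g K(2) by (auto simp: bij_betw_def)
    show "\<forall>x y. {x, y} \<in> edges H \<longrightarrow> {g x, g y} \<in> edges G"
    proof (intro allI impI)
      fix x y assume "{x, y} \<in> edges H"
      then have "{x, y} \<in> (\<lambda>e. f ` e) ` edges K" by (simp only: f(2))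
      then obtain e where e: "e \<in> edges K" "f ` e = {x, y}" by (metis imageE)
      have "e \<subseteq> verts K" using K(1) e(1) by (auto simp: simple_graph_def)
      then have "g ` f ` e = e"
        unfolding g_def using f(1) by (metis bij_betw_imp_inj_on inv_into_image_cancel)
      with e K(3) show "{g x, g y} \<in> edges G" by auto
    qed
  qed
qed

lemma contains_star_iff:
  assumes "simple_graph G"
  shows "contains_copy G (star t) \<longleftrightarrow> (\<exists>v\<in>verts G. t \<le> card (neighbours G v))"
proof
  assume "contains_copy G (star t)"
  then obtain K where "K \<in> copies (star t) G" by (auto simp: contains_copy_def)
  then obtain g where emb: "inj_on g (verts (star t))" "g ` verts (star t) \<subseteq> verts G"
    "\<forall>x y. {x, y} \<in> edges (star t) \<longrightarrow> {g x, g y} \<in> edges G"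
    by (rule embedding_of_copy)
  have g: "inj_on g {0..t}" "g ` {0..t} \<subseteq> verts G"
    using emb(1,2) by (simp_all add: star_def)
  have adj: "{g 0, g i} \<in> edges G" if "i \<in> {1..t}" for i
    using that by (intro emb(3)[rule_format]) (auto simp: star_def)
  have "inj_on g {1..t}" using g(1) by (rule inj_on_subset) auto
  then have "t = card (g ` {1..t})" by (simp add: card_image)
  also have "\<dots> \<le> card (neighbours G (g 0))"
    using adj by (intro card_mono finite_neighbours assms) (auto simp: neighbours_def)
  finally show "\<exists>v\<in>verts G. t \<le> card (neighbours G v)" using g(2) by force
next
  assume "\<exists>v\<in>verts G. t \<le> card (neighbours G v)"
  then obtain v where v: "v \<in> verts G" "t \<le> card (neighbours G v)" by auto
  obtain T where T: "T \<subseteq> neighbours G v" "card T = t" "finite T"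
    using obtain_subset_with_card_n[OF v(2)] by metis
  have vT: "v \<notin> T" using T(1) not_self_neighbour[OF assms] by blast
  obtain h where h: "bij_betw h T {1..t}"
    using finite_same_card_bij[of T "{1..t}"] T(2,3) by auto
  define f where "f = h(v := 0)"
  have fT: "f w = h w" if "w \<in> T" for w using that vT by (auto simp: f_def)
  have fv: "f v = 0" by (simp add: f_def)
  have bT: "bij_betw f T {1..t}" using h fT by (simp cong: bij_betw_cong)
  have b: "bij_betw f (insert v T) {0..t}"
  proof -
    have "insert 0 {1..t} = {0..t}" by auto
    then show ?thesis using notIn_Un_bij_betw[OF vT _ bT] fv by simp
  qed
  define K where "K = \<lparr>verts = insert v T, edges = (\<lambda>w. {v, w}) ` T\<rparr>"
  have "subgraph K G"
    using T v(1) vT neighbours_subset_verts[OF assms]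
    by (auto simp: subgraph_def simple_graph_def K_def neighbours_def card_insert_if)
  moreover have "(\<lambda>e. f ` e) ` edges K = edges (star t)"
  proof -
    have "(\<lambda>e. f ` e) ` edges K = (\<lambda>i. {0, i}) ` f ` T"
      using fv by (simp add: K_def image_image)
    also have "\<dots> = edges (star t)"
      using bT by (auto simp: bij_betw_def star_def)
    finally show ?thesis .
  qed
  then have "isomorphic K (star t)"
    using b unfolding isomorphic_def by (intro exI[of _ f]) (simp add: K_def star_def)
  ultimately show "contains_copy G (star t)"
    by (auto simp: contains_copy_def copies_def)
qed

lemma star_saturatedI:
  assumes G: "simple_graph G"
    and le: "\<And>v. v \<in> verts G \<Longrightarrow> card (neighbours G v) \<le> d"
    and eq: "\<And>u v. u \<in> verts G \<Longrightarrow> v \<in> verts G \<Longrightarrow> u \<noteq> v \<Longrightarrow>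
      card (neighbours G u) = d \<or> card (neighbours G v) = d"
  shows "saturated (star (Suc d)) G"
  unfolding saturated_def
proof (intro conjI ballI impI)
  show "\<not> contains_copy G (star (Suc d))"
    using le by (force simp: contains_star_iff[OF G])
next
  fix u v assume uv: "u \<in> verts G" "v \<in> verts G" "u \<noteq> v \<and> {u, v} \<notin> edges G"
  have grow: "Suc (card (neighbours G x)) = card (neighbours (add_edge G u v) x)"
    if "{x, y} = {u, v}" for x y
  proof -
    have "neighbours (add_edge G u v) x = insert y (neighbours G x)"
      using that by (auto simp: neighbours_def add_edge_def doubleton_eq_iff)
    moreover have "y \<notin> neighbours G x" using that uv by (simp add: neighbours_def)
    ultimately show ?thesis using finite_neighbours[OF G] by simp
  qed
  have "Suc d = card (neighbours (add_edge G u v) u) \<or>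
      Suc d = card (neighbours (add_edge G u v) v)"
    using eq[of u v] uv grow[of u v] grow[of v u] by (auto simp: insert_commute)
  moreover have "verts (add_edge G u v) = verts G" by (simp add: add_edge_def)
  moreover have "simple_graph (add_edge G u v)"
    using simple_graph_add_edge[OF G] uv by simp
  ultimately show "contains_copy (add_edge G u v) (star (Suc d))"
    using uv by (auto simp: contains_star_iff)
qed (rule G)

text \<open>Two of the vertices \<open>0\<close>, \<open>1\<close>, \<open>2\<close> of an embedded clique would receive the same colour.\<close>

lemma two_coloured_no_clique:
  fixes c :: "'a \<Rightarrow> bool"
  assumes c: "\<And>x y. {x, y} \<in> edges G \<Longrightarrow> c x \<noteq> c y" and r: "r \<ge> 3"
  shows "copies (complete_graph r) G = {}"
proof (rule ccontr)
  assume "copies (complete_graph r) G \<noteq> {}"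
  then obtain K where "K \<in> copies (complete_graph r) G" by auto
  then obtain g where "inj_on g (verts (complete_graph r))"
    "g ` verts (complete_graph r) \<subseteq> verts G"
    and g: "\<forall>x y. {x, y} \<in> edges (complete_graph r) \<longrightarrow> {g x, g y} \<in> edges G"
    by (rule embedding_of_copy)
  have "c (g x) \<noteq> c (g y)" if "x < r" "y < r" "x \<noteq> y" for x y
    using that g c by (auto simp: complete_graph_def)
  from this[of 0 1] this[of 1 2] this[of 0 2] r show False by auto
qed

section \<open>Regular bipartite graphs with an isolated vertex\<close>

lemma card_translates_below:
  fixes i m d :: nat
  assumes "d \<le> m"
  shows "card {j. j < m \<and> (i + j) mod m < d} = d"
proof -
  let ?f = "\<lambda>j. (i + j) mod m"
  have inj: "inj_on ?f {..<m}"
  proof (rule inj_onI)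
    fix x y assume xy: "x \<in> {..<m}" "y \<in> {..<m}" and "?f x = ?f y"
    then have "[i + x = i + y] (mod m)" by (simp add: cong_def)
    then have "[x = y] (mod m)" by (simp only: cong_add_lcancel_nat)
    with xy show "x = y" by (simp add: cong_def)
  qed
  have "?f ` {..<m} = {..<m}"
    by (rule endo_inj_surj[OF _ _ inj]) auto
  moreover have "?f ` {j. j < m \<and> ?f j < d} = ?f ` {..<m} \<inter> {..<d}"
    by auto
  ultimately have "?f ` {j. j < m \<and> ?f j < d} = {..<d}"
    using assms by auto
  moreover have "inj_on ?f {j. j < m \<and> ?f j < d}"
    by (rule inj_on_subset[OF inj]) auto
  ultimately show ?thesis using card_image by fastforce
qed

text \<open>The classes are \<open>{..<m}\<close> and \<open>{m..<2 * m}\<close>; the vertices from \<open>2 * m\<close> on are isolated.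
  Adjacency by the sum, rather than the difference, of the indices makes the two classes
  interchangeable.\<close>

definition residue_graph :: "nat \<Rightarrow> nat \<Rightarrow> nat \<Rightarrow> nat graph" where
  "residue_graph n m d =
     \<lparr>verts = {..<n}, edges = {{i, m + j} | i j. i < m \<and> j < m \<and> (i + j) mod m < d}\<rparr>"

lemma verts_residue_graph [simp]: "verts (residue_graph n m d) = {..<n}"
  by (simp add: residue_graph_def)

lemma residue_graph_edgeE:
  assumes "e \<in> edges (residue_graph n m d)"
  obtains i j where "e = {i, m + j}" "i < m" "j < m" "(i + j) mod m < d"
  using assms by (auto simp: residue_graph_def)

lemma simple_residue_graph:
  assumes "2 * m \<le> n"
  shows "simple_graph (residue_graph n m d)"
  unfolding simple_graph_def
proof (intro conjI ballI)
  fix e assume "e \<in> edges (residue_graph n m d)"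
  then obtain i j where "e = {i, m + j}" "i < m" "j < m"
    by (rule residue_graph_edgeE)
  then show "e \<subseteq> verts (residue_graph n m d)" "card e = 2"
    using assms by simp_all
qed simp

lemma residue_graph_two_coloured:
  assumes "{x, y} \<in> edges (residue_graph n m d)"
  shows "(x < m) \<noteq> (y < m)"
proof -
  from assms obtain i j where "{x, y} = {i, m + j}" "i < m"
    by (rule residue_graph_edgeE)
  then show ?thesis by (auto simp: doubleton_eq_iff)
qed

lemma neighbours_residue_graph_left:
  assumes "i < m"
  shows "neighbours (residue_graph n m d) i = (+) m ` {j. j < m \<and> (i + j) mod m < d}"
  using assms by (auto simp: neighbours_def residue_graph_def doubleton_eq_iff)

lemma neighbours_residue_graph_right:
  assumes "j < m"
  shows "neighbours (residue_graph n m d) (m + j) = {i. i < m \<and> (j + i) mod m < d}"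
  using assms by (auto simp: neighbours_def residue_graph_def doubleton_eq_iff add.commute)

lemma neighbours_residue_graph_outside:
  assumes "2 * m \<le> v"
  shows "neighbours (residue_graph n m d) v = {}"
  using assms by (auto simp: neighbours_def residue_graph_def doubleton_eq_iff)

lemma degree_residue_graph:
  assumes "d \<le> m"
  shows "card (neighbours (residue_graph n m d) v) = (if v < 2 * m then d else 0)"
proof -
  consider "v < m" | j where "v = m + j" "j < m" | "2 * m \<le> v"
    by (metis add_less_cancel_left le_add_diff_inverse mult_2 not_le_imp_less)
  then show ?thesis
  proof cases
    case 1
    then show ?thesis
      by (simp add: neighbours_residue_graph_left card_image card_translates_below[OF assms])
  next
    case 2
    then show ?thesis
      by (simp add: neighbours_residue_graph_right card_translates_below[OF assms])
  next
    case 3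
    then show ?thesis by (simp add: neighbours_residue_graph_outside)
  qed
qed

lemma saturated_residue_graph:
  assumes m: "m = n div 2" and d: "d \<le> m"
  shows "saturated (star (Suc d)) (residue_graph n m d)"
proof (rule star_saturatedI)
  show "simple_graph (residue_graph n m d)"
    by (rule simple_residue_graph) (simp add: m)
next
  fix v show "card (neighbours (residue_graph n m d) v) \<le> d"
    by (simp add: degree_residue_graph[OF d])
next
  fix u v
  assume uv: "u \<in> verts (residue_graph n m d)" "v \<in> verts (residue_graph n m d)" "u \<noteq> v"
  have "n \<le> 2 * m + 1" unfolding m by linarith
  with uv have "u < 2 * m \<or> v < 2 * m" by auto
  then show "card (neighbours (residue_graph n m d) u) = d \<or>
      card (neighbours (residue_graph n m d) v) = d"
    by (auto simp: degree_residue_graph[OF d])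
qed

section \<open>Saturation numbers of stars\<close>

theorem sat_clique_star_eq_0:
  assumes "r \<ge> 3" "d \<le> n div 2"
  shows "sat (complete_graph r) n (star (Suc d)) = 0"
proof -
  let ?G = "residue_graph n (n div 2) d"
  have "copies (complete_graph r) ?G = {}"
    using residue_graph_two_coloured assms(1) by (rule two_coloured_no_clique)
  then have "sat (complete_graph r) n (star (Suc d)) \<le> enat 0"
    unfolding sat_def using saturated_residue_graph[OF refl assms(2)]
    by (intro INF_lower2[of ?G]) auto
  then show ?thesis by (simp add: zero_enat_def[symmetric])
qed

theorem corollary2p3:
  "(\<forall>r t n :: nat. r \<ge> 3 \<and> t \<ge> 3 \<and> n \<ge> 2 * t - 2 \<longrightarrow> sat (complete_graph r) n (star t) = 0) \<and>
   (\<forall>r n :: nat. r \<ge> 3 \<and> n \<ge> 2 \<longrightarrow> sat (complete_graph r) n (star 1) = 0) \<and>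
   (\<forall>r n :: nat. r \<ge> 3 \<and> n \<ge> 3 \<longrightarrow> sat (complete_graph r) n (star 2) = 0)"
proof -
  have "sat (complete_graph r) n (star t) = 0" if "r \<ge> 3" "t \<ge> 1" "n \<ge> 2 * t - 2" for r t n
    using sat_clique_star_eq_0[of r "t - 1" n] that by simp
  then show ?thesis by simp
qed

end
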